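(* Let $\mathcal{A}$ be Kac--Paljutkin's finite quantum group, and let $L_2,\dots,L_7$ be the unital left coideal subalgebras of $\mathcal{A}$ listed in the context. Any solvable series for $\mathcal{A}$ of length $4$ (i.e. consisting of four unital left coideal subalgebras, with proper inclusions) is one of the following: 1. $\mathbb{C}1\subset L_5\subset L_2\subset\mathcal{A}$; 2. $\mathbb{C}1\subset L_5\subset L_3\subset\mathcal{A}$; 3. $\mathbb{C}1\subset L_5\subset L_4\subset\mathcal{A}$; 4. $\mathbb{C}1\subset L_6\subset L_4\subset\mathcal{A}$; 5. $\mathbb{C}1\subset L_7\subset L_4\subset\mathcal{A}$.
   Context: All vector spaces and algebras are over $\mathbb{C}$; $\mathbb{M}_2$ is the algebra of complex $2\times 2$ matrices. **Kac--Paljutkin's finite quantum group.** As a $*$-algebra $\mathcal{A}=\mathbb{C}\oplus\mathbb{C}\oplus\mathbb{C}\oplus\mathbb{C}\oplus\mathbb{M}_2$. Let $e_1,e_2,e_3,e_4$ be the units of the four one-dimensional summands and $a_{ij}$ ($i,j=1,2$) the matrix units of $\mathbb{M}_2$; these $8$ elements form a basis. The comultiplication $\Delta$, counit $\epsilon$ and antipode $S$ are given by $$\Delta(e_1)=e_1\otimes e_1+e_2\otimes e_2+e_3\otimes e_3+e_4\otimes e_4+\tfrac12(a_{11}\otimes a_{11}+a_{12}\otimes a_{12}+a_{21}\otimes a_{21}+a_{22}\otimes a_{22}),$$ $$\Delta(e_2)=e_1\otimes e_2+e_2\otimes e_1+e_3\otimes e_4+e_4\otimes e_3+\tfrac12 a_{11}\otimes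 a_{22}+\tfrac12 a_{22}\otimes a_{11}-\tfrac{\sqrt{-1}}2a_{12}\otimes a_{21}+\tfrac{\sqrt{-1}}2a_{21}\otimes a_{12},$$ $$\Delta(e_3)=e_1\otimes e_3+e_3\otimes e_1+e_2\otimes e_4+e_4\otimes e_2+\tfrac12 a_{11}\otimes a_{22}+\tfrac12 a_{22}\otimes a_{11}+\tfrac{\sqrt{-1}}2a_{12}\otimes a_{21}-\tfrac{\sqrt{-1}}2a_{21}\otimes a_{12},$$ $$\Delta(e_4)=e_1\otimes e_4+e_4\otimes e_1+e_2\otimes e_3+e_3\otimes e_2+\tfrac12 a_{11}\otimes a_{11}+\tfrac12 a_{22}\otimes a_{22}-\tfrac12a_{12}\otimes a_{12}-\tfrac12a_{21}\otimes a_{21},$$ $$\Delta(a_{11})=e_1\otimes a_{11}+a_{11}\otimes e_1+e_2\otimes a_{22}+a_{22}\otimes e_2+e_3\otimes a_{22}+a_{22}\otimes e_3+e_4\otimes a_{11}+a_{11}\otimes e_4,$$ $$\Delta(a_{12})=e_1\otimes a_{12}+a_{12}\otimes e_1+\sqrt{-1}\,e_2\otimes a_{21}-\sqrt{-1}\,a_{21}\otimes e_2-\sqrt{-1}\,e_3\otimes a_{21}+\sqrt{-1}\,a_{21}\otimes e_3-e_4\otimes a_{12}-a_{12}\otimes e_4,$$ $$\Delta(a_{21})=e_1\otimes a_{21}+a_{21}\otimes e_1-\sqrt{-1}\,e_2\otimes a_{12}+\sqrt{-1}\,a_{12}\otimes e_2+\sqrt{-1}\,e_3\otimes a_{12}-\sqrt{-1}\,a_{12}\otimes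 e_3-e_4\otimes a_{21}-a_{21}\otimes e_4,$$ $$\Delta(a_{22})=e_1\otimes a_{22}+a_{22}\otimes e_1+e_2\otimes a_{11}+a_{11}\otimes e_2+e_3\otimes a_{11}+a_{11}\otimes e_3+e_4\otimes a_{22}+a_{22}\otimes e_4,$$ $\epsilon(e_1)=1$, $\epsilon(e_2)=\epsilon(e_3)=\epsilon(e_4)=0$, $\epsilon(a_{ij})=0$, $S(e_i)=e_i$, $S(a_{ij})=a_{ji}$. **Coideal subalgebras.** $L_2=\mathrm{span}\{e_1+e_2,\ e_3+e_4,\ a_{11}+a_{22},\ a_{12}-\sqrt{-1}\,a_{21}\}$, $L_3=\mathrm{span}\{e_1+e_3,\ e_2+e_4,\ a_{11}+a_{22},\ a_{12}+\sqrt{-1}\,a_{21}\}$, $L_4=\mathrm{span}\{e_1+e_4,\ e_2+e_3,\ a_{11},\ a_{22}\}$, $L_5=\mathrm{span}\{e_1+e_2+e_3+e_4,\ a_{11}+a_{22}\}$, $L_6=\mathrm{span}\{e_1+e_4+a_{11},\ e_2+e_3+a_{22}\}$, $L_7=\mathrm{span}\{e_1+e_4+a_{22},\ e_2+e_3+a_{11}\}$. **Definitions.** Let $A$ be a semisimple Hopf algebra, with Sweedler notation $\Delta(a)=a_{(1)}\otimes a_{(2)}$. A unital left coideal subalgebra of $A$ is a unital subalgebra $L\subseteq A$ with $\Delta(L)\subseteq A\otimes L$. An integral of $L$ is a nonzero element $l\in L$ with $lx=xl=\epsilon(x)l$ for all $x\in L$ (unique up to a nonzero scalar). For $a,b\in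 A$ put $a\bullet_{\mathrm{ad}} b=a_{(1)}\,b\,S(a_{(2)})$. $Z(\cdot)$ denotes the center of an algebra. A chain $K_0\subset K_1\subset\cdots\subset K_i$ of unital left coideal subalgebras of $A$ is a solvable series if for all $0\le j\le i-1$, with $l_j$ the integral of $K_j$: (1) $l_j\in Z(K_{j+1})$; (2) $(a\bullet_{\mathrm{ad}} b)\,l_j=\epsilon(a)\,b\,l_j$ for all $a,b\in K_{j+1}$. *)

theory Defs
  imports "HOL-Analysis.Analysis"
begin

datatype kp_index = E1 | E2 | E3 | E4 | A11 | A12 | A21 | A22

instance kp_index :: finite
proof
  have "(UNIV :: kp_index set) = {E1, E2, E3, E4, A11, A12, A21, A22}"
    using kp_index.exhaust by blast
  then show "finite (UNIV :: kp_index set)"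
    by (metis finite.emptyI finite.insertI)
qed

text \<open>
  The algebra is modelled by coordinates with respect to the basis
  \<open>e\<^sub>1, \<dots>, e\<^sub>4, a\<^sub>1\<^sub>1, \<dots>, a\<^sub>2\<^sub>2\<close>, and its tensor square by coordinates with respect to the
  products of basis elements. Scalar multiplication is \<open>*s\<close>, and spans and subspaces
  are the complex ones \<open>vec.span\<close> and \<open>vec.subspace\<close>. The library operations \<open>*\<close> and \<open>1\<close> on
  this type are the pointwise ones and are \<^emph>\<open>not\<close> those of the algebra.
\<close>

type_synonym kp = "complex ^ kp_index"
type_synonym kp_tensor = "complex ^ (kp_index \<times> kp_index)"

abbreviation kp_basis :: "kp_index \<Rightarrow> kp" where
  "kp_basis k \<equiv> axis k 1"

abbreviation "e1 \<equiv> kp_basis E1"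
abbreviation "e2 \<equiv> kp_basis E2"
abbreviation "e3 \<equiv> kp_basis E3"
abbreviation "e4 \<equiv> kp_basis E4"
abbreviation "a11 \<equiv> kp_basis A11"
abbreviation "a12 \<equiv> kp_basis A12"
abbreviation "a21 \<equiv> kp_basis A21"
abbreviation "a22 \<equiv> kp_basis A22"

definition kp_tensor :: "kp \<Rightarrow> kp \<Rightarrow> kp_tensor" (infixr "\<otimes>" 75) where
  "x \<otimes> y = (\<chi> p. x $ fst p * y $ snd p)"

definition kp_mult :: "kp \<Rightarrow> kp \<Rightarrow> kp" (infixl "\<odot>" 70) where
  "x \<odot> y = (\<chi> k. case k of
      E1 \<Rightarrow> x $ E1 * y $ E1
    | E2 \<Rightarrow> x $ E2 * y $ E2
    | E3 \<Rightarrow> x $ E3 * y $ E3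
    | E4 \<Rightarrow> x $ E4 * y $ E4
    | A11 \<Rightarrow> x $ A11 * y $ A11 + x $ A12 * y $ A21
    | A12 \<Rightarrow> x $ A11 * y $ A12 + x $ A12 * y $ A22
    | A21 \<Rightarrow> x $ A21 * y $ A11 + x $ A22 * y $ A21
    | A22 \<Rightarrow> x $ A21 * y $ A12 + x $ A22 * y $ A22)"

definition kp_one :: kp where
  "kp_one = e1 + e2 + e3 + e4 + a11 + a22"

fun kp_comult_basis :: "kp_index \<Rightarrow> kp_tensor" where
  "kp_comult_basis E1 = e1 \<otimes> e1 + e2 \<otimes> e2 + e3 \<otimes> e3 + e4 \<otimes> e4
     + (1/2) *s (a11 \<otimes> a11 + a12 \<otimes> a12 + a21 \<otimes> a21 + a22 \<otimes> a22)"
| "kp_comult_basis E2 = e1 \<otimes> e2 + e2 \<otimes> e1 + e3 \<otimes> e4 + e4 \<otimes> e3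
     + (1/2) *s (a11 \<otimes> a22) + (1/2) *s (a22 \<otimes> a11)
     - (\<i>/2) *s (a12 \<otimes> a21) + (\<i>/2) *s (a21 \<otimes> a12)"
| "kp_comult_basis E3 = e1 \<otimes> e3 + e3 \<otimes> e1 + e2 \<otimes> e4 + e4 \<otimes> e2
     + (1/2) *s (a11 \<otimes> a22) + (1/2) *s (a22 \<otimes> a11)
     + (\<i>/2) *s (a12 \<otimes> a21) - (\<i>/2) *s (a21 \<otimes> a12)"
| "kp_comult_basis E4 = e1 \<otimes> e4 + e4 \<otimes> e1 + e2 \<otimes> e3 + e3 \<otimes> e2
     + (1/2) *s (a11 \<otimes> a11) + (1/2) *s (a22 \<otimes> a22)
     - (1/2) *s (a12 \<otimes> a12) - (1/2) *s (a21 \<otimes> a21)"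
| "kp_comult_basis A11 = e1 \<otimes> a11 + a11 \<otimes> e1 + e2 \<otimes> a22 + a22 \<otimes> e2
     + e3 \<otimes> a22 + a22 \<otimes> e3 + e4 \<otimes> a11 + a11 \<otimes> e4"
| "kp_comult_basis A12 = e1 \<otimes> a12 + a12 \<otimes> e1 + \<i> *s (e2 \<otimes> a21) - \<i> *s (a21 \<otimes> e2)
     - \<i> *s (e3 \<otimes> a21) + \<i> *s (a21 \<otimes> e3) - e4 \<otimes> a12 - a12 \<otimes> e4"
| "kp_comult_basis A21 = e1 \<otimes> a21 + a21 \<otimes> e1 - \<i> *s (e2 \<otimes> a12) + \<i> *s (a12 \<otimes> e2)
     + \<i> *s (e3 \<otimes> a12) - \<i> *s (a12 \<otimes> e3) - e4 \<otimes> a21 - a21 \<otimes> e4"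
| "kp_comult_basis A22 = e1 \<otimes> a22 + a22 \<otimes> e1 + e2 \<otimes> a11 + a11 \<otimes> e2
     + e3 \<otimes> a11 + a11 \<otimes> e3 + e4 \<otimes> a22 + a22 \<otimes> e4"

definition kp_comult :: "kp \<Rightarrow> kp_tensor" where
  "kp_comult x = (\<Sum>k\<in>UNIV. (x $ k) *s kp_comult_basis k)"

definition kp_counit :: "kp \<Rightarrow> complex" where
  "kp_counit x = x $ E1"

definition kp_antipode :: "kp \<Rightarrow> kp" where
  "kp_antipode x = (\<chi> k. case k of A12 \<Rightarrow> x $ A21 | A21 \<Rightarrow> x $ A12 | _ \<Rightarrow> x $ k)"

definition kp_tensor_space :: "kp set \<Rightarrow> kp set \<Rightarrow> kp_tensor set" where
  "kp_tensor_space U V = vec.span {x \<otimes> y | x y. x \<in> U \<and> y \<in> V}"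

definition unital_subalgebra :: "kp set \<Rightarrow> bool" where
  "unital_subalgebra L \<longleftrightarrow>
     vec.subspace L \<and> kp_one \<in> L \<and> (\<forall>x\<in>L. \<forall>y\<in>L. x \<odot> y \<in> L)"

definition unital_left_coideal_subalgebra :: "kp set \<Rightarrow> bool" where
  "unital_left_coideal_subalgebra L \<longleftrightarrow>
     unital_subalgebra L \<and> kp_comult ` L \<subseteq> kp_tensor_space UNIV L"

definition is_integral :: "kp set \<Rightarrow> kp \<Rightarrow> bool" where
  "is_integral L l \<longleftrightarrow> l \<in> L \<and> l \<noteq> 0 \<and>
     (\<forall>x\<in>L. l \<odot> x = kp_counit x *s l \<and> x \<odot> l = kp_counit x *s l)"

definition alg_center :: "kp set \<Rightarrow> kp set" where
  "alg_center L = {z \<in> L. \<forall>x\<in>L. z \<odot> x = x \<odot> z}"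

text \<open>
  The adjoint action \<open>a\<^sub>(\<^sub>1\<^sub>) b S(a\<^sub>(\<^sub>2\<^sub>))\<close>: the coefficient of \<open>kp_comult a\<close> at \<open>(i, j)\<close> is that of the
  tensor product of the basis elements with indices \<open>i\<close> and \<open>j\<close>.
\<close>

definition ad_action :: "kp \<Rightarrow> kp \<Rightarrow> kp" where
  "ad_action a b = (\<Sum>(i, j)\<in>UNIV.
     (kp_comult a $ (i, j)) *s (kp_basis i \<odot> b \<odot> kp_antipode (kp_basis j)))"

text \<open>
  A chain \<open>K\<^sub>0 \<subseteq> \<dots> \<subseteq> K\<^sub>i\<close> is a nonempty list of length \<open>i + 1\<close>. The conditions on \<open>l\<close> do not
  depend on the choice of the integral, which is unique up to a nonzero scalar.
\<close>

definition solvable_series :: "kp set list \<Rightarrow> bool" where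
  "solvable_series K \<longleftrightarrow> K \<noteq> [] \<and>
     (\<forall>L\<in>set K. unital_left_coideal_subalgebra L) \<and>
     (\<forall>j. Suc j < length K \<longrightarrow> K ! j \<subseteq> K ! Suc j \<and>
        (\<exists>l. is_integral (K ! j) l \<and>
           l \<in> alg_center (K ! Suc j) \<and>
           (\<forall>a\<in>K ! Suc j. \<forall>b\<in>K ! Suc j.
              ad_action a b \<odot> l = kp_counit a *s (b \<odot> l))))"

definition kp_scalars :: "kp set" where
  "kp_scalars = vec.span {kp_one}"

definition L2 :: "kp set" where
  "L2 = vec.span {e1 + e2, e3 + e4, a11 + a22, a12 - \<i> *s a21}"

definition L3 :: "kp set" where
  "L3 = vec.span {e1 + e3, e2 + e4, a11 + a22, a12 + \<i> *s a21}"

definition L4 :: "kp set" where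
  "L4 = vec.span {e1 + e4, e2 + e3, a11, a22}"

definition L5 :: "kp set" where
  "L5 = vec.span {e1 + e2 + e3 + e4, a11 + a22}"

definition L6 :: "kp set" where
  "L6 = vec.span {e1 + e4 + a11, e2 + e3 + a22}"

definition L7 :: "kp set" where
  "L7 = vec.span {e1 + e4 + a22, e2 + e3 + a11}"

end

theory Submission
  imports Defs
begin

text \<open>
  The unital left coideal subalgebras are exactly \<open>\<complex>1, L\<^sub>2, \<dots>, L\<^sub>7\<close> and the whole algebra, and
  their inclusions admit only the listed chains with three proper steps. For the classification,
  a left coideal is stable under all maps \<open>(f \<otimes> id) \<circ> \<Delta>\<close>, so as
  a comodule it splits along the four group-like elements and the \<open>4\<close>-dimensional complement
  spanned by \<open>e\<^sub>1 - e\<^sub>4, e\<^sub>2 - e\<^sub>3, a\<^sub>1\<^sub>2, a\<^sub>2\<^sub>1\<close>, which is a double copy of one simple comodule. The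
  simple subcomodules of the complement form a projective line with homogeneous coordinates
  \<open>[s : t]\<close>. Closure under multiplication forces \<open>t = 0\<close> (giving \<open>L\<^sub>2\<close>), \<open>s = 0\<close> (giving \<open>L\<^sub>3\<close>) or the
  whole algebra; if the complement is missed, the subalgebra is spanned by a group of group-likes.
\<close>

lemma UNIV_kp_index: "UNIV = {E1, E2, E3, E4, A11, A12, A21, A22}"
  using kp_index.exhaust by blast

lemma all_kp_index: "(\<forall>k. P k) \<longleftrightarrow> P E1 \<and> P E2 \<and> P E3 \<and> P E4 \<and> P A11 \<and> P A12 \<and> P A21 \<and> P A22"
  by (metis kp_index.exhaust)

lemma kp_eq_iff:
  fixes x y :: kp
  shows "x = y \<longleftrightarrow> x $ E1 = y $ E1 \<and> x $ E2 = y $ E2 \<and> x $ E3 = y $ E3 \<and> x $ E4 = y $ E4 \<and>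
    x $ A11 = y $ A11 \<and> x $ A12 = y $ A12 \<and> x $ A21 = y $ A21 \<and> x $ A22 = y $ A22"
  by (simp add: vec_eq_iff all_kp_index)

section \<open>Slices of the comultiplication and the comodule decomposition\<close>

text \<open>The map (f \<otimes> id) \<circ> \<Delta> for the coordinate functional f at index
  \<open>i\<close>.\<close>

definition slice :: "kp_index \<Rightarrow> kp \<Rightarrow> kp" where
  "slice i x = (\<chi> k. kp_comult x $ (i, k))"

lemma slice_nth: "slice i x $ k = (\<Sum>j\<in>UNIV. x $ j * kp_comult_basis j $ (i, k))"
  by (simp add: slice_def kp_comult_def)

definition group_like_chi :: kp where
  "group_like_chi = e1 + e2 + e3 + e4 - a11 - a22"

definition group_like_plus :: kp where
  "group_like_plus = e1 - e2 - e3 + e4 + a11 - a22"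

definition group_like_minus :: kp where
  "group_like_minus = e1 - e2 - e3 + e4 - a11 + a22"

text \<open>
  \<open>pvec s t\<close> and \<open>qvec t s\<close> span the simple subcomodule with coordinates \<open>[s : t]\<close>: they are the
  eigenvectors, for \<open>1\<close> and \<open>-1\<close>, of half the difference of the slices at \<open>e\<^sub>2\<close> and \<open>e\<^sub>3\<close>.
\<close>

definition pvec :: "complex \<Rightarrow> complex \<Rightarrow> kp" where
  "pvec s t = s *s (e1 + e2 - e3 - e4) + t *s (a12 + \<i> *s a21)"

definition qvec :: "complex \<Rightarrow> complex \<Rightarrow> kp" where
  "qvec s t = s *s (e1 - e2 + e3 - e4) + t *s (a12 - \<i> *s a21)"

lemmas kp_vector_defs = kp_one_def group_like_chi_def group_like_plus_def group_like_minus_def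
  pvec_def qvec_def

text \<open>This is the Haar functional h. For the other group-likes g, which are their own
  inverses, the coefficient is h(\<open>g \<odot> x\<close>).\<close>

definition coeff_one :: "kp \<Rightarrow> complex" where
  "coeff_one x = (x $ E1 + x $ E2 + x $ E3 + x $ E4 + 2 * x $ A11 + 2 * x $ A22) / 8"

definition coeff_chi :: "kp \<Rightarrow> complex" where
  "coeff_chi x = (x $ E1 + x $ E2 + x $ E3 + x $ E4 - 2 * x $ A11 - 2 * x $ A22) / 8"

definition coeff_plus :: "kp \<Rightarrow> complex" where
  "coeff_plus x = (x $ E1 - x $ E2 - x $ E3 + x $ E4 + 2 * x $ A11 - 2 * x $ A22) / 8"

definition coeff_minus :: "kp \<Rightarrow> complex" where
  "coeff_minus x = (x $ E1 - x $ E2 - x $ E3 + x $ E4 - 2 * x $ A11 + 2 * x $ A22) / 8"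

text \<open>\<open>p_part\<close> and \<open>q_part\<close> project onto the two planes swept out by
  all \<open>pvec s t\<close> and all \<open>qvec s t\<close>.\<close>

definition p_part :: "kp \<Rightarrow> kp" where
  "p_part x = pvec ((x $ E1 + x $ E2 - x $ E3 - x $ E4) / 4) ((x $ A12 - \<i> * x $ A21) / 2)"

definition q_part :: "kp \<Rightarrow> kp" where
  "q_part x = qvec ((x $ E1 - x $ E2 + x $ E3 - x $ E4) / 4) ((x $ A12 + \<i> * x $ A21) / 2)"

lemmas coeff_defs = coeff_one_def coeff_chi_def coeff_plus_def coeff_minus_def p_part_def q_part_def

lemma decomposition:
  "x = coeff_one x *s kp_one + coeff_chi x *s group_like_chi + coeff_plus x *s group_like_plus
     + coeff_minus x *s group_like_minus + p_part x + q_part x"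
  by (simp add: kp_eq_iff kp_vector_defs coeff_defs axis_def field_simps)

text \<open>The projections onto the summands are convolutions with functionals, hence preserve left coideals.\<close>

lemma coeff_chi_slice:
  "coeff_chi x *s group_like_chi = (1/8) *s (slice E1 x + slice E2 x + slice E3 x + slice E4 x
     - 2 *s slice A11 x - 2 *s slice A22 x)"
  by (simp add: kp_eq_iff kp_vector_defs coeff_defs axis_def field_simps slice_nth UNIV_kp_index kp_tensor_def)

lemma coeff_plus_slice:
  "coeff_plus x *s group_like_plus = (1/8) *s (slice E1 x - slice E2 x - slice E3 x + slice E4 x
     + 2 *s slice A11 x - 2 *s slice A22 x)"
  by (simp add: kp_eq_iff kp_vector_defs coeff_defs axis_def field_simps slice_nth UNIV_kp_index kp_tensor_def)

lemma coeff_minus_slice: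
  "coeff_minus x *s group_like_minus = (1/8) *s (slice E1 x - slice E2 x - slice E3 x + slice E4 x
     - 2 *s slice A11 x + 2 *s slice A22 x)"
  by (simp add: kp_eq_iff kp_vector_defs coeff_defs axis_def field_simps slice_nth UNIV_kp_index kp_tensor_def)

lemma p_part_slice:
  "p_part x = (1/4) *s (slice E1 x + slice E2 x - slice E3 x - slice E4 x)"
  by (simp add: kp_eq_iff kp_vector_defs coeff_defs axis_def field_simps slice_nth UNIV_kp_index kp_tensor_def)

lemma q_part_slice:
  "q_part x = (1/4) *s (slice E1 x - slice E2 x + slice E3 x - slice E4 x)"
  by (simp add: kp_eq_iff kp_vector_defs coeff_defs axis_def field_simps slice_nth UNIV_kp_index kp_tensor_def)

text \<open>The slice at \<open>a12\<close> swaps the two eigenvectors inside one simple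
  subcomodule, so a left coideal contains both or neither.\<close>

lemma slice_A12_pvec: "slice A12 (pvec s t) = qvec t s"
  by (simp add: kp_eq_iff kp_vector_defs axis_def field_simps slice_nth UNIV_kp_index kp_tensor_def)

lemma slice_A12_qvec: "slice A12 (qvec s t) = pvec t s"
  by (simp add: kp_eq_iff kp_vector_defs axis_def field_simps slice_nth UNIV_kp_index kp_tensor_def)

text \<open>Reading off row \<open>i\<close> of a tensor is linear and sends
  \<open>y \<otimes> u\<close> to a multiple of \<open>u\<close>, so it maps the span into
  \<open>L\<close>.\<close>

lemma slice_mem:
  assumes L: "unital_left_coideal_subalgebra L" and "x \<in> L"
  shows "slice i x \<in> L"
proof -
  have sub: "vec.subspace L"
    using L by (simp add: unital_left_coideal_subalgebra_def unital_subalgebra_def)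
  have "(\<chi> k. w $ (i, k)) \<in> L" if "w \<in> kp_tensor_space UNIV L" for w
    using that unfolding kp_tensor_space_def
  proof (induction rule: vec.span_induct_alt)
    case base
    have "(\<chi> k. (0::kp_tensor) $ (i, k)) = (0::kp)" by (simp add: vec_eq_iff)
    then show ?case using vec.subspace_0[OF sub] by simp
  next
    case (step c z w)
    then obtain y u where z: "z = y \<otimes> u" and "u \<in> L" by auto
    have "(\<chi> k. (c *s z + w) $ (i, k)) = (c * y $ i) *s u + (\<chi> k. w $ (i, k))"
      by (simp add: vec_eq_iff z kp_tensor_def)
    then show ?case
      using step \<open>u \<in> L\<close> by (simp add: vec.subspace_add[OF sub] vec.subspace_scale[OF sub])
  qed
  then show ?thesis
    using assms by (auto simp: unital_left_coideal_subalgebra_def slice_def)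
qed

section \<open>Linear equations for the listed subalgebras\<close>

lemma mem_kp_scalars_iff:
  "x \<in> kp_scalars \<longleftrightarrow> (\<forall>k. x $ k = (if k \<in> {A12, A21} then 0 else x $ E1))"
  by (auto simp: kp_scalars_def vec.span_breakdown_eq kp_eq_iff all_kp_index kp_one_def axis_def)

lemma mem_L2_iff:
  "x \<in> L2 \<longleftrightarrow> x $ E1 = x $ E2 \<and> x $ E3 = x $ E4 \<and> x $ A11 = x $ A22 \<and> x $ A21 + x $ A12 * \<i> = 0"
  by (auto simp: L2_def vec.span_breakdown_eq kp_eq_iff axis_def)

lemma mem_L3_iff:
  "x \<in> L3 \<longleftrightarrow> x $ E1 = x $ E3 \<and> x $ E2 = x $ E4 \<and> x $ A11 = x $ A22 \<and> x $ A21 = \<i> * x $ A12"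
  by (auto simp: L3_def vec.span_breakdown_eq kp_eq_iff axis_def)

lemma mem_L4_iff:
  "x \<in> L4 \<longleftrightarrow> x $ E1 = x $ E4 \<and> x $ E2 = x $ E3 \<and> x $ A12 = 0 \<and> x $ A21 = 0"
  by (auto simp: L4_def vec.span_breakdown_eq kp_eq_iff axis_def)

lemma mem_L5_iff:
  "x \<in> L5 \<longleftrightarrow> x $ E1 = x $ E2 \<and> x $ E1 = x $ E3 \<and> x $ E1 = x $ E4 \<and> x $ A11 = x $ A22 \<and>
     x $ A12 = 0 \<and> x $ A21 = 0"
  by (auto simp: L5_def vec.span_breakdown_eq kp_eq_iff axis_def)

lemma mem_L6_iff:
  "x \<in> L6 \<longleftrightarrow> x $ E1 = x $ E4 \<and> x $ E2 = x $ E3 \<and> x $ A11 = x $ E1 \<and> x $ A22 = x $ E2 \<and>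
     x $ A12 = 0 \<and> x $ A21 = 0"
  by (auto simp: L6_def vec.span_breakdown_eq kp_eq_iff axis_def)

lemma mem_L7_iff:
  "x \<in> L7 \<longleftrightarrow> x $ E1 = x $ E4 \<and> x $ E2 = x $ E3 \<and> x $ A22 = x $ E1 \<and> x $ A11 = x $ E2 \<and>
     x $ A12 = 0 \<and> x $ A21 = 0"
  by (auto simp: L7_def vec.span_breakdown_eq kp_eq_iff axis_def)

lemma kp_mult_nth:
  "(x \<odot> y) $ E1 = x $ E1 * y $ E1"
  "(x \<odot> y) $ E2 = x $ E2 * y $ E2"
  "(x \<odot> y) $ E3 = x $ E3 * y $ E3"
  "(x \<odot> y) $ E4 = x $ E4 * y $ E4"
  "(x \<odot> y) $ A11 = x $ A11 * y $ A11 + x $ A12 * y $ A21"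
  "(x \<odot> y) $ A12 = x $ A11 * y $ A12 + x $ A12 * y $ A22"
  "(x \<odot> y) $ A21 = x $ A21 * y $ A11 + x $ A22 * y $ A21"
  "(x \<odot> y) $ A22 = x $ A21 * y $ A12 + x $ A22 * y $ A22"
  by (simp_all add: kp_mult_def)

definition coideals :: "kp set set" where
  "coideals = {kp_scalars, L2, L3, L4, L5, L6, L7, UNIV}"

section \<open>Classification of the unital left coideal subalgebras\<close>

locale left_coideal_subalgebra =
  fixes L :: "kp set"
  assumes coideal: "unital_left_coideal_subalgebra L"
begin

lemma subspace: "vec.subspace L"
  using coideal by (simp add: unital_left_coideal_subalgebra_def unital_subalgebra_def)

lemmas add_mem = vec.subspace_add[OF subspace]
  and diff_mem = vec.subspace_diff[OF subspace]
  and scale_mem = vec.subspace_scale[OF subspace]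

lemma one_mem: "kp_one \<in> L"
  using coideal by (simp add: unital_left_coideal_subalgebra_def unital_subalgebra_def)

lemma mult_mem: "x \<in> L \<Longrightarrow> y \<in> L \<Longrightarrow> x \<odot> y \<in> L"
  using coideal by (simp add: unital_left_coideal_subalgebra_def unital_subalgebra_def)

lemma scalars_subset: "kp_scalars \<subseteq> L"
  using vec.span_minimal[OF _ subspace] one_mem by (simp add: kp_scalars_def)

lemmas slice_closed = slice_mem[OF coideal]

lemmas closure = add_mem diff_mem scale_mem slice_closed

lemma scale_mem_iff: "c *s x \<in> L \<longleftrightarrow> c = 0 \<or> x \<in> L"
proof
  assume "c *s x \<in> L"
  then show "c = 0 \<or> x \<in> L"
    using scale_mem[of "c *s x" "inverse c"] by (cases "c = 0") auto
next
  assume "c = 0 \<or> x \<in> L"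
  then show "c *s x \<in> L"
    using scale_mem vec.subspace_0[OF subspace] by auto
qed

lemma qvec_mem_iff: "qvec s t \<in> L \<longleftrightarrow> pvec t s \<in> L"
  using slice_closed[of "qvec s t" A12] slice_closed[of "pvec t s" A12]
  by (auto simp: slice_A12_pvec slice_A12_qvec)

text \<open>The projections are combinations of slices, so \<open>L\<close> contains all components
  of its elements. Hence \<open>L\<close> is determined by its group-likes and its vectors
  \<open>pvec s t\<close>.\<close>

lemma mem_iff:
  "x \<in> L \<longleftrightarrow> (coeff_chi x = 0 \<or> group_like_chi \<in> L) \<and> (coeff_plus x = 0 \<or> group_like_plus \<in> L) \<and>
     (coeff_minus x = 0 \<or> group_like_minus \<in> L) \<and> p_part x \<in> L \<and> q_part x \<in> L"
  (is "_ \<longleftrightarrow> ?R")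
proof
  assume x: "x \<in> L"
  have "coeff_chi x *s group_like_chi \<in> L" "coeff_plus x *s group_like_plus \<in> L"
    "coeff_minus x *s group_like_minus \<in> L" "p_part x \<in> L" "q_part x \<in> L"
    unfolding coeff_chi_slice coeff_plus_slice coeff_minus_slice p_part_slice q_part_slice
    by (intro closure x)+
  then show ?R by (simp add: scale_mem_iff)
next
  assume ?R
  then have "coeff_one x *s kp_one + coeff_chi x *s group_like_chi + coeff_plus x *s group_like_plus
      + coeff_minus x *s group_like_minus + p_part x + q_part x \<in> L"
    by (intro add_mem) (auto simp: scale_mem_iff one_mem)
  then show "x \<in> L"
    by (simp flip: decomposition)
qed

lemma eq_UNIV:
  assumes p: "pvec s t \<in> L" and "s \<noteq> 0" "t \<noteq> 0"
  shows "L = UNIV"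
proof -
  have q: "qvec t s \<in> L"
    using p by (simp add: qvec_mem_iff)
  \<comment> \<open>The one-dimensional summands commute, so the commutator lives in the matrix
    block, where it is diagonal.\<close>
  have "(2 * \<i> * s * t) *s (a22 - a11) = pvec s t \<odot> qvec t s - qvec t s \<odot> pvec s t"
    by (simp add: kp_eq_iff kp_mult_nth kp_vector_defs axis_def algebra_simps)
  also have "\<dots> \<in> L"
    by (intro diff_mem mult_mem p q)
  finally have d: "a22 - a11 \<in> L"
    using assms(2,3) unfolding scale_mem_iff by simp
  \<comment> \<open>The square is the unit of the matrix block, a central idempotent that separates
    the two terms of \<open>pvec s t\<close>.\<close>
  have "a11 + a22 = (a22 - a11) \<odot> (a22 - a11)"
    by (simp add: kp_eq_iff kp_mult_nth axis_def)
  also have "\<dots> \<in> L"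
    by (intro mult_mem d)
  finally have a: "a11 + a22 \<in> L" .
  have "s *s pvec 1 0 = (kp_one - (a11 + a22)) \<odot> pvec s t"
    by (simp add: kp_eq_iff kp_mult_nth kp_vector_defs axis_def algebra_simps)
  also have "\<dots> \<in> L"
    by (intro mult_mem diff_mem one_mem a p)
  finally have p1: "pvec 1 0 \<in> L"
    using assms(2) by (simp add: scale_mem_iff)
  have "t *s pvec 0 1 = (a11 + a22) \<odot> pvec s t"
    by (simp add: kp_eq_iff kp_mult_nth kp_vector_defs axis_def algebra_simps)
  also have "\<dots> \<in> L"
    by (intro mult_mem a p)
  finally have p2: "pvec 0 1 \<in> L"
    using assms(3) by (simp add: scale_mem_iff)
  have p_all: "pvec s t \<in> L" for s t
  proof -
    have "s *s pvec 1 0 + t *s pvec 0 1 \<in> L"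
      by (intro closure p1 p2)
    also have "s *s pvec 1 0 + t *s pvec 0 1 = pvec s t"
      by (simp add: kp_eq_iff kp_vector_defs)
    finally show ?thesis .
  qed
  have q_all: "qvec s t \<in> L" for s t
    by (simp add: qvec_mem_iff p_all)
  have "e1 + e4 - e2 - e3 = pvec 1 0 \<odot> qvec 1 0"
    by (simp add: kp_eq_iff kp_mult_nth kp_vector_defs axis_def)
  also have "\<dots> \<in> L"
    by (intro mult_mem p_all q_all)
  finally have e: "e1 + e4 - e2 - e3 \<in> L" .
  have "group_like_chi = kp_one - 2 *s (a11 + a22)"
    "group_like_plus = (e1 + e4 - e2 - e3) - (a22 - a11)"
    "group_like_minus = (e1 + e4 - e2 - e3) + (a22 - a11)"
    by (simp_all add: kp_eq_iff kp_vector_defs axis_def)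
  then have "group_like_chi \<in> L" "group_like_plus \<in> L" "group_like_minus \<in> L"
    by (metis e a d one_mem closure)+
  then have "x \<in> L" for x
    using p_all q_all by (simp add: mem_iff[of x] p_part_def q_part_def)
  then show ?thesis
    by blast
qed

text \<open>The four group-likes form a Klein four-group.\<close>

lemma group_like_mults:
  "group_like_chi \<in> L \<Longrightarrow> group_like_plus \<in> L \<Longrightarrow> group_like_minus \<in> L"
  "group_like_chi \<in> L \<Longrightarrow> group_like_minus \<in> L \<Longrightarrow> group_like_plus \<in> L"
  "group_like_plus \<in> L \<Longrightarrow> group_like_minus \<in> L \<Longrightarrow> group_like_chi \<in> L"
proof -
  have "group_like_minus = group_like_chi \<odot> group_like_plus"
    "group_like_plus = group_like_chi \<odot> group_like_minus"
    "group_like_chi = group_like_plus \<odot> group_like_minus"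
    by (simp_all add: kp_eq_iff kp_mult_nth kp_vector_defs axis_def)
  then show "group_like_chi \<in> L \<Longrightarrow> group_like_plus \<in> L \<Longrightarrow> group_like_minus \<in> L"
    "group_like_chi \<in> L \<Longrightarrow> group_like_minus \<in> L \<Longrightarrow> group_like_plus \<in> L"
    "group_like_plus \<in> L \<Longrightarrow> group_like_minus \<in> L \<Longrightarrow> group_like_chi \<in> L"
    by (metis mult_mem)+
qed

lemma pvec_not_both:
  assumes "L \<noteq> UNIV" "pvec 1 0 \<in> L"
  shows "pvec 0 1 \<notin> L"
proof
  assume "pvec 0 1 \<in> L"
  then have "pvec 1 0 + pvec 0 1 \<in> L"
    using assms by (intro closure)
  also have "pvec 1 0 + pvec 0 1 = pvec 1 1"
    by (simp add: pvec_def)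
  finally show False
    using eq_UNIV[of 1 1] assms(1) by simp
qed

text \<open>By \<open>eq_UNIV\<close>, a proper \<open>L\<close> can only meet the projective line
  at [1 : 0] or [0 : 1]; \<open>pvec 0 0\<close> is the zero vector.\<close>

lemma pvec_mem_iff:
  assumes "L \<noteq> UNIV"
  shows "pvec s t \<in> L \<longleftrightarrow> (s = 0 \<or> pvec 1 0 \<in> L \<and> t = 0) \<and> (t = 0 \<or> pvec 0 1 \<in> L \<and> s = 0)"
proof -
  have "pvec s 0 = s *s pvec 1 0" "pvec 0 t = t *s pvec 0 1"
    by (simp_all add: pvec_def)
  then have "pvec s 0 \<in> L \<longleftrightarrow> s = 0 \<or> pvec 1 0 \<in> L" "pvec 0 t \<in> L \<longleftrightarrow> t = 0 \<or> pvec 0 1 \<in> L"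
    by (simp_all only: scale_mem_iff)
  then show ?thesis
    using eq_UNIV[of s t] assms by (cases "s = 0"; cases "t = 0") auto
qed

lemma eq_L2:
  assumes "L \<noteq> UNIV" "pvec 1 0 \<in> L"
  shows "L = L2"
proof -
  \<comment> \<open>The square of \<open>pvec 1 0\<close> is the sum of the four \<open>e\<close>'s,
    that is, half of \<open>kp_one + group_like_chi\<close>.\<close>
  have "group_like_chi = 2 *s (pvec 1 0 \<odot> pvec 1 0) - kp_one"
    by (simp add: kp_eq_iff kp_mult_nth kp_vector_defs axis_def)
  also have "\<dots> \<in> L"
    using assms by (intro closure mult_mem one_mem)
  finally have chi: "group_like_chi \<in> L" .
  have p: "pvec 0 1 \<notin> L"
    using pvec_not_both assms by blast
  have p_iff: "pvec s t \<in> L \<longleftrightarrow> t = 0" for s t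
    using pvec_mem_iff[OF assms(1), of s t] assms(2) p by auto
  \<comment> \<open>\<open>qvec 1 0\<close> belongs to the other point [0 : 1], so
    \<open>group_like_plus\<close> in \<open>L\<close> would force \<open>pvec 0 1\<close> into
    \<open>L\<close>.\<close>
  have "group_like_plus \<odot> pvec 1 0 = qvec 1 0"
    by (simp add: kp_eq_iff kp_mult_nth kp_vector_defs axis_def)
  then have plus: "group_like_plus \<notin> L"
    using mult_mem[of group_like_plus "pvec 1 0"] assms(2) p by (auto simp: qvec_mem_iff)
  then have minus: "group_like_minus \<notin> L"
    using group_like_mults chi by blast
  show ?thesis
  proof (rule set_eqI)
    fix x
    show "x \<in> L \<longleftrightarrow> x \<in> L2"
      unfolding mem_iff[of x] mem_L2_iff using chi plus minus
      \<comment> \<open>What remains are complex linear equations, split into real and imaginary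
        parts for \<open>linarith\<close>.\<close>
      by (simp add: qvec_mem_iff p_iff coeff_defs) (safe; simp add: complex_eq_iff; linarith?)
  qed
qed

lemma eq_L3:
  assumes "L \<noteq> UNIV" "pvec 0 1 \<in> L"
  shows "L = L3"
proof -
  \<comment> \<open>The square of \<open>pvec 0 1\<close> is \<i> times the unit of the matrix
    block.\<close>
  have "group_like_chi = kp_one + (2 * \<i>) *s (pvec 0 1 \<odot> pvec 0 1)"
    by (simp add: kp_eq_iff kp_mult_nth kp_vector_defs axis_def mult.assoc)
  also have "\<dots> \<in> L"
    using assms by (intro closure mult_mem one_mem)
  finally have chi: "group_like_chi \<in> L" .
  have p: "pvec 1 0 \<notin> L"
    using pvec_not_both assms by blast
  have p_iff: "pvec s t \<in> L \<longleftrightarrow> s = 0" for s t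
    using pvec_mem_iff[OF assms(1), of s t] assms(2) p by auto
  have "group_like_plus \<odot> pvec 0 1 = qvec 0 1"
    by (simp add: kp_eq_iff kp_mult_nth kp_vector_defs axis_def)
  then have plus: "group_like_plus \<notin> L"
    using mult_mem[of group_like_plus "pvec 0 1"] assms(2) p by (auto simp: qvec_mem_iff)
  then have minus: "group_like_minus \<notin> L"
    using group_like_mults chi by blast
  show ?thesis
  proof (rule set_eqI)
    fix x
    show "x \<in> L \<longleftrightarrow> x \<in> L3"
      unfolding mem_iff[of x] mem_L3_iff using chi plus minus
      by (simp add: qvec_mem_iff p_iff coeff_defs) (safe; simp add: complex_eq_iff; linarith?)
  qed
qed

lemma classification: "L \<in> coideals"
proof -
  consider "L = UNIV" | "L \<noteq> UNIV" "pvec 1 0 \<in> L" | "L \<noteq> UNIV" "pvec 0 1 \<in> L"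
    | "L \<noteq> UNIV" "pvec 1 0 \<notin> L" "pvec 0 1 \<notin> L"
    by blast
  then show ?thesis
  proof cases
    case 1
    then show ?thesis by (simp add: coideals_def)
  next
    case 2
    then show ?thesis using eq_L2 by (simp add: coideals_def)
  next
    case 3
    then show ?thesis using eq_L3 by (simp add: coideals_def)
  next
    case 4
    have p_iff: "pvec s t \<in> L \<longleftrightarrow> s = 0 \<and> t = 0" for s t
      using pvec_mem_iff[OF 4(1), of s t] 4(2,3) by auto
    note simps = qvec_mem_iff p_iff coeff_defs
    \<comment> \<open>The cases are the five subgroups of the Klein four-group.\<close>
    consider "group_like_chi \<in> L" "group_like_plus \<in> L" "group_like_minus \<in> L"
      | "group_like_chi \<in> L" "group_like_plus \<notin> L" "group_like_minus \<notin> L"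
      | "group_like_chi \<notin> L" "group_like_plus \<in> L" "group_like_minus \<notin> L"
      | "group_like_chi \<notin> L" "group_like_plus \<notin> L" "group_like_minus \<in> L"
      | "group_like_chi \<notin> L" "group_like_plus \<notin> L" "group_like_minus \<notin> L"
      using group_like_mults by blast
    then show ?thesis
    proof cases
      case 1
      have "x \<in> L \<longleftrightarrow> x \<in> L4" for x
        unfolding mem_L4_iff using 1
        by (simp add: mem_iff[of x] simps) (safe; simp add: complex_eq_iff; linarith?)
      then show ?thesis
        unfolding coideals_def by blast
    next
      case 2
      have "x \<in> L \<longleftrightarrow> x \<in> L5" for x
        unfolding mem_L5_iff using 2
        by (simp add: mem_iff[of x] simps) (safe; simp add: complex_eq_iff; linarith?)
      then show ?thesis
        unfolding coideals_def by blast
    next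
      case 3
      have "x \<in> L \<longleftrightarrow> x \<in> L6" for x
        unfolding mem_L6_iff using 3
        by (simp add: mem_iff[of x] simps) (safe; simp add: complex_eq_iff; linarith?)
      then show ?thesis
        unfolding coideals_def by blast
    next
      case 4
      have "x \<in> L \<longleftrightarrow> x \<in> L7" for x
        unfolding mem_L7_iff using 4
        by (simp add: mem_iff[of x] simps) (safe; simp add: complex_eq_iff; linarith?)
      then show ?thesis
        unfolding coideals_def by blast
    next
      case 5
      have "x \<in> L \<longleftrightarrow> x \<in> kp_scalars" for x
        unfolding mem_kp_scalars_iff using 5
        by (simp add: mem_iff[of x] simps all_kp_index) (safe; simp add: complex_eq_iff; linarith?)
      then show ?thesis
        unfolding coideals_def by blast
    qed
  qed
qed

end

text \<open>Each of the eight subalgebras is determined by which of these elements it contains.\<close>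

definition witnesses :: "kp set" where
  "witnesses = {group_like_chi, group_like_plus, group_like_minus, pvec 1 0, pvec 0 1}"

lemma witness_mem:
  "group_like_chi \<notin> kp_scalars" "group_like_plus \<notin> kp_scalars" "group_like_minus \<notin> kp_scalars" "pvec 1 0 \<notin> kp_scalars" "pvec 0 1 \<notin> kp_scalars"
  "group_like_chi \<in> L2" "group_like_plus \<notin> L2" "group_like_minus \<notin> L2" "pvec 1 0 \<in> L2" "pvec 0 1 \<notin> L2"
  "group_like_chi \<in> L3" "group_like_plus \<notin> L3" "group_like_minus \<notin> L3" "pvec 1 0 \<notin> L3" "pvec 0 1 \<in> L3"
  "group_like_chi \<in> L4" "group_like_plus \<in> L4" "group_like_minus \<in> L4" "pvec 1 0 \<notin> L4" "pvec 0 1 \<notin> L4"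
  "group_like_chi \<in> L5" "group_like_plus \<notin> L5" "group_like_minus \<notin> L5" "pvec 1 0 \<notin> L5" "pvec 0 1 \<notin> L5"
  "group_like_chi \<notin> L6" "group_like_plus \<in> L6" "group_like_minus \<notin> L6" "pvec 1 0 \<notin> L6" "pvec 0 1 \<notin> L6"
  "group_like_chi \<notin> L7" "group_like_plus \<notin> L7" "group_like_minus \<in> L7" "pvec 1 0 \<notin> L7" "pvec 0 1 \<notin> L7"
  by (simp_all add: mem_kp_scalars_iff mem_L2_iff mem_L3_iff mem_L4_iff mem_L5_iff mem_L6_iff mem_L7_iff
      all_kp_index kp_vector_defs axis_def)

section \<open>Inclusions and chains\<close>

text \<open>For any other pair allowed by the last two assumptions, either \<open>X = Y\<close> or
  some witness lies in \<open>X\<close> but not in \<open>Y\<close>.\<close>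

lemma psubset_middle:
  assumes "X \<in> coideals" "Y \<in> coideals" "X \<subset> Y" "X \<noteq> kp_scalars" "Y \<noteq> UNIV"
  shows "(X, Y) \<in> {(L5, L2), (L5, L3), (L5, L4), (L6, L4), (L7, L4)}"
proof -
  have "\<forall>w\<in>witnesses. w \<in> X \<longrightarrow> w \<in> Y" and "X \<noteq> Y"
    using assms(3) by blast+
  then show ?thesis
    using assms(1,2,4,5) unfolding coideals_def
    by (elim insertE emptyE; simp add: witnesses_def witness_mem)
qed

lemma psubset_lower:
  assumes "X \<in> coideals" "X \<subset> Y" "Y \<in> {L5, L6, L7}"
  shows "X = kp_scalars"
proof -
  have "\<forall>w\<in>witnesses. w \<in> X \<longrightarrow> w \<in> Y" and "X \<noteq> Y"
    using assms(2) by blast+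
  then show ?thesis
    using assms(1,3) unfolding coideals_def
    by (elim insertE emptyE; simp add: witnesses_def witness_mem)
qed

lemma psubset_upper:
  assumes "Y \<in> coideals" "X \<subset> Y" "X \<in> {L2, L3, L4}"
  shows "Y = UNIV"
proof -
  have "\<forall>w\<in>witnesses. w \<in> X \<longrightarrow> w \<in> Y" and "X \<noteq> Y"
    using assms(2) by blast+
  then show ?thesis
    using assms(1,3) unfolding coideals_def
    by (elim insertE emptyE; simp add: witnesses_def witness_mem)
qed

theorem theorem3p2:
  fixes K :: "kp set list"
  assumes "solvable_series K"
    and "length K = 4"
    and "\<forall>j<3. K ! j \<subset> K ! Suc j"
  shows "K \<in> {[kp_scalars, L5, L2, UNIV],
              [kp_scalars, L5, L3, UNIV],
              [kp_scalars, L5, L4, UNIV],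
              [kp_scalars, L6, L4, UNIV],
              [kp_scalars, L7, L4, UNIV]}"
proof -
  obtain A B C D where K: "K = [A, B, C, D]"
    using assms(2) by (auto simp: numeral_eq_Suc length_Suc_conv)
  have chain: "A \<subset> B" "B \<subset> C" "C \<subset> D"
    using assms(3)[rule_format, of 0] assms(3)[rule_format, of 1] assms(3)[rule_format, of 2]
    by (simp_all add: K)
  have coideal: "left_coideal_subalgebra L" if "L \<in> set K" for L
    using assms(1) that by (simp add: solvable_series_def left_coideal_subalgebra_def)
  then have mem: "A \<in> coideals" "B \<in> coideals" "C \<in> coideals" "D \<in> coideals"
    by (auto simp: K intro: left_coideal_subalgebra.classification)
  \<comment> \<open>\<open>A\<close> already contains the scalars, so \<open>B\<close> is strictly
    larger. The middle pair \<open>(B, C)\<close> then determines both ends of the chain.\<close>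
  have "B \<noteq> kp_scalars"
    using left_coideal_subalgebra.scalars_subset[OF coideal[of A]] chain(1) by (auto simp: K)
  moreover have "C \<noteq> UNIV"
    using chain(3) by auto
  ultimately have BC: "(B, C) \<in> {(L5, L2), (L5, L3), (L5, L4), (L6, L4), (L7, L4)}"
    by (intro psubset_middle mem chain)
  then have "A = kp_scalars"
    by (intro psubset_lower[OF mem(1) chain(1)]) auto
  moreover have "D = UNIV"
    using BC by (intro psubset_upper[OF mem(4) chain(3)]) auto
  ultimately show ?thesis
    using BC by (auto simp: K)
qed

end
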